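(* Let $M\in\mathrm{GL}(2,\mathbb{C})$ and write $N=\begin{pmatrix}1&0\\0&-1\end{pmatrix}$. If $$\operatorname{trace}((NM)^2)\neq\operatorname{trace}(M^2),$$ then the group generated by $M$ and $N$ is rigid.
   Context: Definition of rigidity: let $A_1,\dots,A_k\in\mathrm{GL}(n,\mathbb{C})$ satisfy $\prod_{i=1}^kA_i=\mathrm{id}$, and let $C_j$ denote the conjugacy class of $A_j$ in $\mathrm{GL}(n,\mathbb{C})$. The group $\langle A_1,\dots,A_k\rangle$ is called rigid if, whenever $B_j\in C_j$ $(j=1,\dots,k)$ satisfy $\prod_{i=1}^kB_i=\mathrm{id}$, there is a single $P\in\mathrm{GL}(n,\mathbb{C})$ with $B_j=PA_jP^{-1}$ for all $j=1,\dots,k$. For the group generated by two matrices $M$ and $N$, rigidity refers to the triple $(A_1,A_2,A_3)=(N,\,M,\,(NM)^{-1})$, whose product is the identity. *)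

theory Defs
  imports "HOL-Analysis.Analysis"
begin

definition GL :: "(complex^'n^'n) set" where
  "GL = {A. invertible A}"

definition conj_class :: "complex^'n^'n \<Rightarrow> (complex^'n^'n) set" where
  "conj_class A = {P ** A ** matrix_inv P | P. P \<in> GL}"

definition mat_prod :: "(complex^'n^'n) list \<Rightarrow> complex^'n^'n" where
  "mat_prod As = foldr (**) As (mat 1)"

(* Rigidity is a property of the ordered tuple of generators, not only of the subgroup it
   generates.  The standing requirements on the tuple (invertible entries, product equal to
   the identity) are part of the predicate. *)
definition rigid :: "(complex^'n^'n) list \<Rightarrow> bool" where
  "rigid As \<longleftrightarrow>
     set As \<subseteq> GL \<and> mat_prod As = mat 1 \<and>
     (\<forall>Bs. length Bs = length As \<longrightarrow>
           (\<forall>j<length As. Bs ! j \<in> conj_class (As ! j)) \<longrightarrow>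
           mat_prod Bs = mat 1 \<longrightarrow>
           (\<exists>P\<in>GL. \<forall>j<length As. Bs ! j = P ** (As ! j) ** matrix_inv P))"

definition rigid_group_generated_by :: "complex^'n^'n \<Rightarrow> complex^'n^'n \<Rightarrow> bool" where
  "rigid_group_generated_by M N \<longleftrightarrow> rigid [N, M, matrix_inv (N ** M)]"

end

theory Submission
  imports Defs
begin

text \<open>
  After a simultaneous conjugation a competing triple has first entry \<open>N\<close> itself and second entry
  some \<open>M'\<close>. The invariants \<open>trace M\<close> and \<open>trace (N M)\<close> determine the two diagonal entries of \<open>M'\<close>,
  and then \<open>det M\<close> determines the product of the off-diagonal ones. The trace hypothesis says
  precisely that this product is nonzero, so \<open>M\<close> and \<open>M'\<close> differ by conjugation with a diagonal
  matrix, which commutes with \<open>N\<close>.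
\<close>

lemma GL_matrix_inv:
  assumes "P \<in> GL"
  shows "P ** matrix_inv P = mat 1" "matrix_inv P ** P = mat 1"
proof -
  have "\<exists>A'. P ** A' = mat 1 \<and> A' ** P = mat 1"
    using assms by (simp add: GL_def invertible_def)
  then have "P ** matrix_inv P = mat 1 \<and> matrix_inv P ** P = mat 1"
    unfolding matrix_inv_def by (rule someI_ex)
  then show "P ** matrix_inv P = mat 1" "matrix_inv P ** P = mat 1"
    by blast+
qed

text \<open>For square matrices over a field a right inverse is also a left inverse, so one identity
  pins down the inverse.\<close>

lemma matrix_inv_eqI:
  fixes A B :: "complex^'n^'n"
  assumes "A ** B = mat 1"
  shows "matrix_inv A = B"
proof -
  have "B ** A = mat 1"
    using assms matrix_left_right_inverse by blast
  with assms have "A \<in> GL"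
    unfolding GL_def invertible_def by blast
  then have "matrix_inv A = matrix_inv A ** (A ** B)"
    using assms by simp
  also have "\<dots> = B"
    using \<open>A \<in> GL\<close> by (simp add: matrix_mul_assoc GL_matrix_inv)
  finally show ?thesis .
qed

lemma GL_I: "A ** B = mat 1 \<Longrightarrow> A \<in> GL"
  unfolding GL_def by (metis invertible_right_inverse mem_Collect_eq)

lemma GL_mult: "A \<in> GL \<Longrightarrow> B \<in> GL \<Longrightarrow> A ** B \<in> GL"
  by (simp add: GL_def invertible_mult)

lemma GL_matrix_inv_mem: "A \<in> GL \<Longrightarrow> matrix_inv A \<in> GL"
  using GL_I GL_matrix_inv(2) by blast

lemma matrix_inv_matrix_inv: "A \<in> GL \<Longrightarrow> matrix_inv (matrix_inv A) = A"
  by (simp add: matrix_inv_eqI GL_matrix_inv)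

lemma matrix_inv_mult:
  assumes "A \<in> GL" "B \<in> GL"
  shows "matrix_inv (A ** B) = matrix_inv B ** matrix_inv A"
proof (rule matrix_inv_eqI)
  have "A ** B ** (matrix_inv B ** matrix_inv A) = A ** (B ** matrix_inv B) ** matrix_inv A"
    by (simp add: matrix_mul_assoc)
  then show "A ** B ** (matrix_inv B ** matrix_inv A) = mat 1"
    using assms by (simp add: GL_matrix_inv)
qed

lemma conj_mult:
  assumes "P \<in> GL"
  shows "(P ** A ** matrix_inv P) ** (P ** B ** matrix_inv P) = P ** (A ** B) ** matrix_inv P"
proof -
  have "(P ** A ** matrix_inv P) ** (P ** B ** matrix_inv P)
      = P ** A ** (matrix_inv P ** P) ** B ** matrix_inv P"
    by (simp only: matrix_mul_assoc)
  also have "\<dots> = P ** (A ** B) ** matrix_inv P"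
    using assms by (simp add: GL_matrix_inv matrix_mul_assoc)
  finally show ?thesis .
qed

lemma matrix_inv_conj:
  assumes "P \<in> GL" "A \<in> GL"
  shows "matrix_inv (P ** A ** matrix_inv P) = P ** matrix_inv A ** matrix_inv P"
  using assms
  by (simp add: matrix_inv_mult GL_mult GL_matrix_inv_mem matrix_inv_matrix_inv matrix_mul_assoc)

lemma trace_conj:
  assumes "P \<in> GL"
  shows "trace (P ** A ** matrix_inv P) = trace A"
proof -
  have "trace (P ** A ** matrix_inv P) = trace (matrix_inv P ** P ** A)"
    by (metis matrix_mul_assoc trace_mul_sym)
  then show ?thesis
    using assms by (simp add: GL_matrix_inv)
qed

lemma det_conj:
  assumes "P \<in> GL"
  shows "det (P ** A ** matrix_inv P) = det A"
proof -
  have "det P * det (matrix_inv P) = 1"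
    using assms by (metis GL_matrix_inv(1) det_I det_mul)
  then show ?thesis
    by (simp add: det_mul)
qed

text \<open>Conjugacy can thus be checked as an intertwining relation, without computing with
  inverses.\<close>

lemma conj_eqI:
  assumes "P \<in> GL" "P ** A = B ** P"
  shows "B = P ** A ** matrix_inv P"
  using assms by (simp add: GL_matrix_inv flip: matrix_mul_assoc)

lemma mult_comps_2:
  fixes A B :: "'a::semiring_1^2^2"
  shows "(A ** B) $ i $ j = A $ i $ 1 * B $ 1 $ j + A $ i $ 2 * B $ 2 $ j"
  by (simp add: matrix_matrix_mult_def sum_2)

lemma trace_2: "trace (A :: 'a::semiring_1^2^2) = A $ 1 $ 1 + A $ 2 $ 2"
  by (simp add: trace_def sum_2)

text \<open>The eigenvalues of \<open>N\<close> are distinct, so its centralizer consists of the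
  diagonal matrices; this is the freedom left once the first entry is \<open>N\<close>.\<close>

lemma diagonal_conjugator:
  fixes M M' N :: "complex^2^2"
  assumes N: "N = vector [vector [1, 0], vector [0, -1]]"
    and tr: "trace ((N ** M) ** (N ** M)) \<noteq> trace (M ** M)"
    and trM: "trace M' = trace M"
    and trNM: "trace (N ** M') = trace (N ** M)"
    and det: "det M' = det M"
  obtains D where "D \<in> GL" "D ** N = N ** D" "D ** M = M' ** D"
proof -
  \<comment> \<open>Expanding both traces, their difference is
    \<open>-4 * M $ 1 $ 2 * M $ 2 $ 1\<close>.\<close>
  have nz: "M $ 1 $ 2 * M $ 2 $ 1 \<noteq> 0"
    using tr by (auto simp: N trace_2 mult_comps_2)
  have sum: "M' $ 1 $ 1 + M' $ 2 $ 2 = M $ 1 $ 1 + M $ 2 $ 2"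
    using trM by (simp add: trace_2)
  have diff: "M' $ 1 $ 1 - M' $ 2 $ 2 = M $ 1 $ 1 - M $ 2 $ 2"
    using trNM by (simp add: N trace_2 mult_comps_2)
  have "2 * M' $ 1 $ 1 = 2 * M $ 1 $ 1" "2 * M' $ 2 $ 2 = 2 * M $ 2 $ 2"
    using sum diff by algebra+
  then have diag: "M' $ 1 $ 1 = M $ 1 $ 1" "M' $ 2 $ 2 = M $ 2 $ 2"
    by simp_all
  have off: "M' $ 1 $ 2 * M' $ 2 $ 1 = M $ 1 $ 2 * M $ 2 $ 1"
    using det diag by (simp add: det_2)
  \<comment> \<open>Conjugation by \<open>diag(x, y)\<close> multiplies the upper off-diagonal entry
    by \<open>x / y\<close> and the lower one by \<open>y / x\<close>. The choice of
    \<open>x / y\<close> matches the upper entries; \<open>off\<close> then matches the lower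
    ones.\<close>
  define D :: "complex^2^2" where
    "D = vector [vector [M' $ 1 $ 2, 0], vector [0, M $ 1 $ 2]]"
  show ?thesis
  proof
    have "det D \<noteq> 0"
      using nz off by (auto simp: D_def det_2)
    then show "D \<in> GL"
      by (simp add: GL_def invertible_det_nz)
    show "D ** N = N ** D"
      by (simp add: D_def N vec_eq_iff forall_2 mult_comps_2)
    show "D ** M = M' ** D"
      using off by (simp add: D_def diag vec_eq_iff forall_2 mult_comps_2 mult.commute)
  qed
qed

theorem theorem3p10:
  fixes M N :: "complex^2^2"
  assumes M: "M \<in> GL"
    and N: "N = vector [vector [1, 0], vector [0, -1]]"
    and tr: "trace ((N ** M) ** (N ** M)) \<noteq> trace (M ** M)"
  shows "rigid_group_generated_by M N"
proof -
  have N_GL: "N \<in> GL"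
    by (simp add: GL_def invertible_det_nz N det_2)
  have NM_GL: "N ** M \<in> GL"
    using M N_GL by (rule GL_mult[rotated])
  have conj: "\<exists>Q\<in>GL. B1 = Q ** N ** matrix_inv Q \<and> B2 = Q ** M ** matrix_inv Q
      \<and> B3 = Q ** matrix_inv (N ** M) ** matrix_inv Q"
    if B1: "B1 \<in> conj_class N" and B2: "B2 \<in> conj_class M"
      and B3: "B3 \<in> conj_class (matrix_inv (N ** M))" and prod: "B1 ** B2 ** B3 = mat 1"
    for B1 B2 B3
  proof -
    obtain P where P: "P \<in> GL" "B1 = P ** N ** matrix_inv P"
      using B1 by (auto simp: conj_class_def)
    obtain R where R: "R \<in> GL" "B2 = R ** M ** matrix_inv R"
      using B2 by (auto simp: conj_class_def)
    obtain S where S: "S \<in> GL" "B3 = S ** matrix_inv (N ** M) ** matrix_inv S"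
      using B3 by (auto simp: conj_class_def)
    have B3_eq: "B3 = matrix_inv (B1 ** B2)"
      using prod by (simp add: matrix_inv_eqI)
    \<comment> \<open>The third class enters here: it makes \<open>B1 ** B2\<close> conjugate to
      \<open>N ** M\<close>, which fixes its trace.\<close>
    then have "B1 ** B2 = matrix_inv B3"
      using GL_I[OF prod] by (simp add: matrix_inv_matrix_inv)
    also have "\<dots> = S ** (N ** M) ** matrix_inv S"
      using S NM_GL by (simp add: matrix_inv_conj GL_matrix_inv_mem matrix_inv_matrix_inv)
    finally have tr12: "trace (B1 ** B2) = trace (N ** M)"
      using S(1) by (simp add: trace_conj)
    \<comment> \<open>Undoing \<open>P\<close> moves \<open>B1\<close> back to \<open>N\<close> and
      \<open>B2\<close> to \<open>M'\<close>.\<close>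
    define M' where "M' = matrix_inv P ** B2 ** P"
    have B2_eq: "B2 = P ** M' ** matrix_inv P"
      using P(1) by (intro conj_eqI) (simp_all add: M'_def matrix_mul_assoc GL_matrix_inv)
    have "trace M' = trace M"
      using B2_eq R P(1) by (metis trace_conj)
    moreover have "trace (N ** M') = trace (N ** M)"
      using tr12 P by (simp add: B2_eq conj_mult trace_conj)
    moreover have "det M' = det M"
      using B2_eq R P(1) by (metis det_conj)
    ultimately obtain D where D: "D \<in> GL" "D ** N = N ** D" "D ** M = M' ** D"
      using diagonal_conjugator[OF N tr] by blast
    \<comment> \<open>\<open>P ** D\<close> is the common conjugator: \<open>D\<close> fixes
      \<open>N\<close> and takes \<open>M\<close> to \<open>M'\<close>, after which \<open>P\<close>
      takes \<open>N\<close> to \<open>B1\<close> and \<open>M'\<close> to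
      \<open>B2\<close>.\<close>
    have PD: "P ** D \<in> GL"
      using P(1) D(1) by (rule GL_mult)
    have "P ** D ** N = B1 ** (P ** D)"
    proof -
      have "B1 ** (P ** D) = P ** N ** (matrix_inv P ** P) ** D"
        by (simp only: P(2) matrix_mul_assoc)
      then show ?thesis
        using P(1) D(2) by (simp add: GL_matrix_inv flip: matrix_mul_assoc)
    qed
    then have 1: "B1 = P ** D ** N ** matrix_inv (P ** D)"
      by (rule conj_eqI[OF PD])
    have "P ** D ** M = B2 ** (P ** D)"
    proof -
      have "B2 ** (P ** D) = P ** M' ** (matrix_inv P ** P) ** D"
        by (simp only: B2_eq matrix_mul_assoc)
      then show ?thesis
        using P(1) D(3) by (simp add: GL_matrix_inv flip: matrix_mul_assoc)
    qed
    then have 2: "B2 = P ** D ** M ** matrix_inv (P ** D)"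
      by (rule conj_eqI[OF PD])
    \<comment> \<open>The third entry follows from the first two, since conjugation respects
      products and inverses.\<close>
    have "B3 = P ** D ** matrix_inv (N ** M) ** matrix_inv (P ** D)"
      unfolding B3_eq 1 2 using PD NM_GL by (simp only: conj_mult matrix_inv_conj)
    with 1 2 PD show ?thesis
      by blast
  qed
  show ?thesis
    unfolding rigid_group_generated_by_def rigid_def
  proof (intro conjI allI impI)
    show "set [N, M, matrix_inv (N ** M)] \<subseteq> GL"
      using M N_GL NM_GL by (simp add: GL_matrix_inv_mem)
    show "mat_prod [N, M, matrix_inv (N ** M)] = mat 1"
      using NM_GL by (simp add: mat_prod_def matrix_mul_assoc GL_matrix_inv)
    fix Bs :: "(complex^2^2) list"
    assume len: "length Bs = length [N, M, matrix_inv (N ** M)]"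
      and cls: "\<forall>j<length [N, M, matrix_inv (N ** M)].
        Bs ! j \<in> conj_class ([N, M, matrix_inv (N ** M)] ! j)"
      and prod: "mat_prod Bs = mat 1"
    obtain B1 B2 B3 where Bs: "Bs = [B1, B2, B3]"
      using len by (auto simp: length_Suc_conv)
    show "\<exists>P\<in>GL. \<forall>j<length [N, M, matrix_inv (N ** M)].
        Bs ! j = P ** ([N, M, matrix_inv (N ** M)] ! j) ** matrix_inv P"
      \<comment> \<open>The quantifiers over indices below 3 unfold into three conjuncts each;
        \<open>conj_ac\<close> absorbs the difference in their order.\<close>
      using conj[of B1 B2 B3] cls prod
      by (simp add: Bs mat_prod_def matrix_mul_assoc All_less_Suc numeral_3_eq_3 conj_ac)
  qed
qed

end
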